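(* Let $\mathbf{k}$ be a commutative ring, $q\in\mathbf{k}$, $r:=q+1$, and assume that $r$ is invertible in $\mathbf{k}$. Then: (a) The family $\left(\eta_\alpha^{(q)}\right)_{\alpha\in\mathrm{Comp}}$ is a basis of the $\mathbf{k}$-module $\mathrm{QSym}$. (b) Let $n\in\mathbb{N}$, and let $\mathrm{QSym}_n$ be the $n$-th graded component of the graded $\mathbf{k}$-module $\mathrm{QSym}$. Then the family $\left(\eta_\alpha^{(q)}\right)_{\alpha\in\mathrm{Comp}_n}$ is a basis of the $\mathbf{k}$-module $\mathrm{QSym}_n$.
   Context: $\mathbb{N}=\{0,1,2,\ldots\}$; for an integer $m$, $[m]=\{1,2,\ldots,m\}$ (empty if $m\le 0$). A composition is a finite tuple $\alpha=(\alpha_1,\ldots,\alpha_k)$ of positive integers; its length is $\ell(\alpha)=k$, its size is $|\alpha|=\alpha_1+\cdots+\alpha_k$. $\mathrm{Comp}$ is the set of all compositions (including the empty one $\varnothing$), and $\mathrm{Comp}_n$ the set of compositions of size $n$. For $\alpha=(\alpha_1,\ldots,\alpha_k)\in\mathrm{Comp}_n$ set $D(\alpha)=\{\alpha_1+\cdots+\alpha_i \mid i\in[k-1]\}\subseteq[n-1]$; the map $D$ is a bijection from $\mathrm{Comp}_n$ to the set of subsets of $[n-1]$. $\mathrm{QSym}$ is the $\mathbf{k}$-algebra of quasisymmetric functions over $\mathbf{k}$: the formal power series $f\in\mathbf{k}[[x_1,x_2,x_3,\ldots]]$ of bounded degree such that for all positive integers $a_1,\ldots,a_\ell$ and all $i_1<\cdots<i_\ell$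 and $j_1<\cdots<j_\ell$, the coefficients of $x_{i_1}^{a_1}\cdots x_{i_\ell}^{a_\ell}$ and $x_{j_1}^{a_1}\cdots x_{j_\ell}^{a_\ell}$ in $f$ are equal. It is graded by degree. For a composition $\alpha=(\alpha_1,\ldots,\alpha_\ell)$, $M_\alpha=\sum_{i_1<i_2<\cdots<i_\ell}x_{i_1}^{\alpha_1}\cdots x_{i_\ell}^{\alpha_\ell}$; the family $(M_\alpha)_{\alpha\in\mathrm{Comp}}$ is a $\mathbf{k}$-basis of $\mathrm{QSym}$. For $\alpha\in\mathrm{Comp}_n$, the enriched $q$-monomial function is $$\eta_\alpha^{(q)}=\sum_{\beta\in\mathrm{Comp}_n;\ D(\beta)\subseteq D(\alpha)}r^{\ell(\beta)}M_\beta\in\mathrm{QSym}.$$ *)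

theory Defs
  imports "HOL-Library.Poly_Mapping"
begin

text \<open>
  The base ring is a type of sort \<open>{comm_ring, comm_monoid_mult}\<close>: commutative rings with unity,
  i.e. \<open>comm_ring_1\<close> without the axiom \<open>0 \<noteq> 1\<close>, so that the zero ring is not excluded.

  A monomial in countably many variables is its finitely supported exponent vector, and a formal
  power series is its coefficient function. The index \<open>i :: nat\<close> stands for the variable
  \<open>x\<^bsub>i+1\<^esub>\<close>; only the order of the indices matters below.
\<close>

type_synonym monom = "nat \<Rightarrow>\<^sub>0 nat"
type_synonym 'k series = "monom \<Rightarrow> 'k"

definition mdeg :: "monom \<Rightarrow> nat" where
  "mdeg m = (\<Sum>i\<in>Poly_Mapping.keys m. Poly_Mapping.lookup m i)"

text \<open>\<open>x_pow [i\<^sub>1,\<dots>,i\<^sub>l] [a\<^sub>1,\<dots>,a\<^sub>l]\<close> is the product of the \<open>x\<close>-variables with indices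
  \<open>i\<^sub>1,\<dots>,i\<^sub>l\<close>, raised to the exponents \<open>a\<^sub>1,\<dots>,a\<^sub>l\<close> (exponent vectors add).\<close>

definition x_pow :: "nat list \<Rightarrow> nat list \<Rightarrow> monom" where
  "x_pow is as = sum_list (map2 Poly_Mapping.single is as)"


subsection \<open>Compositions\<close>

definition Comp :: "nat list set" where
  "Comp = {\<alpha>. \<forall>a\<in>set \<alpha>. 0 < a}"

definition Comp_n :: "nat \<Rightarrow> nat list set" where
  "Comp_n n = {\<alpha> \<in> Comp. sum_list \<alpha> = n}"

definition D :: "nat list \<Rightarrow> nat set" where
  "D \<alpha> = {sum_list (take i \<alpha>) | i. i \<in> {1..length \<alpha> - 1}}"

lemma finite_Comp_n: "finite (Comp_n n)"
proof (rule finite_subset)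
  show "Comp_n n \<subseteq> {\<alpha>. set \<alpha> \<subseteq> {..n} \<and> length \<alpha> \<le> n}"
  proof
    fix \<alpha> assume "\<alpha> \<in> Comp_n n"
    then have pos: "\<forall>a\<in>set \<alpha>. 0 < a" and s: "sum_list \<alpha> = n"
      by (auto simp: Comp_n_def Comp_def)
    have "length \<alpha> \<le> sum_list \<alpha>" using pos by (induction \<alpha>) auto
    moreover have "set \<alpha> \<subseteq> {..n}" using member_le_sum_list s by auto
    ultimately show "\<alpha> \<in> {\<alpha>. set \<alpha> \<subseteq> {..n} \<and> length \<alpha> \<le> n}" using s by simp
  qed
  show "finite {\<alpha>. set \<alpha> \<subseteq> {..n} \<and> length \<alpha> \<le> n}"
    by (rule finite_lists_length_le) simp
qed


subsection \<open>Quasisymmetric functions\<close>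

definition QSym :: "'k::{comm_ring, comm_monoid_mult} series set" where
  "QSym = {f. (\<exists>d. \<forall>m. f m \<noteq> 0 \<longrightarrow> mdeg m \<le> d) \<and>
    (\<forall>as is js. (\<forall>a\<in>set as. 0 < a) \<and> length is = length as \<and> length js = length as \<and>
       sorted_wrt (<) is \<and> sorted_wrt (<) js \<longrightarrow> f (x_pow is as) = f (x_pow js as))}"

definition QSym_n :: "nat \<Rightarrow> 'k::{comm_ring, comm_monoid_mult} series set" where
  "QSym_n n = {f \<in> QSym. \<forall>m. f m \<noteq> 0 \<longrightarrow> mdeg m = n}"

text \<open>The coefficients of \<open>M \<alpha>\<close> are 0 or 1, because for a composition \<open>\<alpha>\<close> distinct index
  sequences give distinct monomials (lemma \<open>x_pow_inj\<close>).\<close>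

definition M :: "nat list \<Rightarrow> 'k::{comm_ring, comm_monoid_mult} series" where
  "M \<alpha> = (\<lambda>m. if \<exists>is. length is = length \<alpha> \<and> sorted_wrt (<) is \<and> m = x_pow is \<alpha>
               then 1 else 0)"

lemma keys_x_pow:
  "length is = length as \<Longrightarrow> \<forall>a\<in>set as. 0 < a \<Longrightarrow> Poly_Mapping.keys (x_pow is as) = set is"
proof (induction "is" as rule: list_induct2)
  case Nil
  then show ?case by (simp add: x_pow_def)
next
  case (Cons i "is" a as)
  have "x_pow (i # is) (a # as) = Poly_Mapping.single i a + x_pow is as"
    by (simp add: x_pow_def)
  moreover have "Poly_Mapping.keys (p + q) = Poly_Mapping.keys p \<union> Poly_Mapping.keys q" for p q :: monom
    by (auto simp: in_keys_iff lookup_add)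
  ultimately show ?case using Cons by simp
qed

lemma x_pow_inj:
  assumes "\<alpha> \<in> Comp" "length is = length \<alpha>" "length js = length \<alpha>"
    and "sorted_wrt (<) is" "sorted_wrt (<) js" and "x_pow is \<alpha> = x_pow js \<alpha>"
  shows "is = js"
  using assms keys_x_pow[of "is" \<alpha>] keys_x_pow[of js \<alpha>]
  by (auto simp: Comp_def intro: strict_sorted_equal)

definition eta :: "'k::{comm_ring, comm_monoid_mult} \<Rightarrow> nat list \<Rightarrow> 'k series" where
  "eta q \<alpha> = (\<lambda>m. \<Sum>\<beta> | \<beta> \<in> Comp_n (sum_list \<alpha>) \<and> D \<beta> \<subseteq> D \<alpha>. (q + 1) ^ length \<beta> * M \<beta> m)"


subsection \<open>Bases\<close>

definition lincomb ::
  "('i \<Rightarrow> 'k::{comm_ring, comm_monoid_mult}) \<Rightarrow> ('i \<Rightarrow> 'k series) \<Rightarrow> 'i set \<Rightarrow> 'k series" where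
  "lincomb c v J = (\<lambda>m. \<Sum>i\<in>J. c i * v i m)"

definition is_submodule :: "'k::{comm_ring, comm_monoid_mult} series set \<Rightarrow> bool" where
  "is_submodule N \<longleftrightarrow> (\<lambda>m. 0) \<in> N \<and> (\<forall>f\<in>N. \<forall>g\<in>N. (\<lambda>m. f m + g m) \<in> N) \<and>
     (\<forall>c. \<forall>f\<in>N. (\<lambda>m. c * f m) \<in> N)"

text \<open>\<open>(v i)\<close>, indexed by \<open>i \<in> I\<close>, is a basis of the module \<open>N\<close>. This is a property of the family
  (not just of its set of values): linear independence forbids repetitions over a nonzero ring.\<close>

definition is_basis ::
  "'k::{comm_ring, comm_monoid_mult} series set \<Rightarrow> 'i set \<Rightarrow> ('i \<Rightarrow> 'k series) \<Rightarrow> bool" where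
  "is_basis N I v \<longleftrightarrow> is_submodule N \<and> (\<forall>i\<in>I. v i \<in> N) \<and>
     (\<forall>J c. finite J \<and> J \<subseteq> I \<and> lincomb c v J = (\<lambda>m. 0) \<longrightarrow> (\<forall>i\<in>J. c i = 0)) \<and>
     (\<forall>f\<in>N. \<exists>J c. finite J \<and> J \<subseteq> I \<and> f = lincomb c v J)"

lemma is_submodule_QSym: "is_submodule QSym"
proof -
  have "(\<lambda>m. f m + g m) \<in> QSym" if fg: "f \<in> QSym" "g \<in> QSym" for f g :: "'a series"
  proof -
    obtain d e where "\<forall>m. f m \<noteq> 0 \<longrightarrow> mdeg m \<le> d" "\<forall>m. g m \<noteq> 0 \<longrightarrow> mdeg m \<le> e"
      using fg by (auto simp: QSym_def)
    then have "\<forall>m. f m + g m \<noteq> 0 \<longrightarrow> mdeg m \<le> max d e"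
      by (metis add.right_neutral le_max_iff_disj)
    moreover have "f (x_pow is as) + g (x_pow is as) = f (x_pow js as) + g (x_pow js as)"
      if "\<forall>a\<in>set as. 0 < a" "length is = length as" "length js = length as"
        "sorted_wrt (<) is" "sorted_wrt (<) js" for as "is" js
    proof -
      have "f (x_pow is as) = f (x_pow js as)" "g (x_pow is as) = g (x_pow js as)"
        using fg that unfolding QSym_def by blast+
      then show ?thesis by simp
    qed
    ultimately show ?thesis unfolding QSym_def by blast
  qed
  moreover have "(\<lambda>m. c * f m) \<in> QSym" if f: "f \<in> QSym" for c and f :: "'a series"
  proof -
    obtain d where "\<forall>m. f m \<noteq> 0 \<longrightarrow> mdeg m \<le> d"
      using f by (auto simp: QSym_def)
    then have "\<forall>m. c * f m \<noteq> 0 \<longrightarrow> mdeg m \<le> d"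
      by (metis mult_zero_right)
    moreover have "c * f (x_pow is as) = c * f (x_pow js as)"
      if "\<forall>a\<in>set as. 0 < a" "length is = length as" "length js = length as"
        "sorted_wrt (<) is" "sorted_wrt (<) js" for as "is" js
    proof -
      have "f (x_pow is as) = f (x_pow js as)"
        using f that unfolding QSym_def by blast
      then show ?thesis by simp
    qed
    ultimately show ?thesis unfolding QSym_def by blast
  qed
  moreover have "(\<lambda>m. 0) \<in> (QSym :: 'a series set)" by (simp add: QSym_def)
  ultimately show ?thesis unfolding is_submodule_def by blast
qed

end

theory Submission imports Defs begin

text \<open>
  Every monomial is \<open>x_pow is \<beta>\<close> for a composition \<open>\<beta>\<close> and an increasing index list \<open>is\<close>
  (\<open>monom_eq_x_pow\<close>), and the coefficients of a quasisymmetric function depend on \<open>\<beta>\<close> only. So a quasisymmetric function is the same thing as its coordinate vector,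
  indexed by compositions. In these coordinates \<open>eta q \<alpha>\<close> has the entry
  \<open>(q + 1) ^ length \<beta>\<close> at each \<open>\<beta>\<close> of the same size with \<open>D \<beta> \<subseteq> D \<alpha>\<close>, and zeros elsewhere
  (\<open>eta_x_pow\<close>).

  Within one size, \<open>D\<close> is injective, and for nonempty \<open>\<alpha>\<close> the set \<open>D \<alpha>\<close> has one element less
  than \<open>\<alpha>\<close> has parts, so
  \<open>D \<beta> \<subseteq> D \<alpha>\<close> with \<open>\<beta> \<noteq> \<alpha>\<close> forces \<open>\<beta>\<close> to be shorter than \<open>\<alpha>\<close> (\<open>D_subset_imp_shorter\<close>).
  Hence the matrix of coordinates is triangular with respect to length, and its diagonal entries are
  powers of the unit \<open>q + 1\<close>. Triangular systems with invertible diagonal have exactly one solution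
  (\<open>triangular_solvable\<close>, \<open>triangular_unique\<close>): uniqueness is linear independence of the
  \<open>eta q \<alpha>\<close>, and existence shows that they span. Sizes never mix, so the same argument serves the
  whole module, where a bound on the degree leaves finitely many compositions, and each
  graded component.
\<close>

section \<open>Triangular linear systems\<close>

text \<open>Ordering the unknowns by rank, the equation at an index of least rank is the only one that
  involves the unknown of that index; so it can be solved last, after all the other unknowns.\<close>

lemma triangular_solvable:
  fixes A :: "'i \<Rightarrow> 'i \<Rightarrow> 'k::{comm_ring, comm_monoid_mult}" and rank :: "'i \<Rightarrow> nat"
  assumes "finite J"
    and "\<And>i. i \<in> J \<Longrightarrow> A i i dvd 1"
    and "\<And>i j. i \<in> J \<Longrightarrow> j \<in> J \<Longrightarrow> A i j \<noteq> 0 \<Longrightarrow> i = j \<or> rank i < rank j"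
  shows "\<exists>c. \<forall>i\<in>J. (\<Sum>j\<in>J. c j * A i j) = g i"
  using assms
  \<comment> \<open>The sign makes the induction insert indices in order of decreasing rank.\<close>
proof (induction J rule: finite_ranking_induct[where f = "\<lambda>i. - int (rank i)"])
  case empty
  then show ?case by simp
next
  case (insert x J)
  then obtain c where c: "\<forall>i\<in>J. (\<Sum>j\<in>J. c j * A i j) = g i" by auto
  obtain s where s: "1 = A x x * s" using insert.prems(1)[of x] by (auto elim: dvdE)
  show ?case
  proof (cases "x \<in> J")
    case True
    then show ?thesis using c by (auto simp: insert_absorb)
  next
    case False
    define d where "d = c(x := s * (g x - (\<Sum>j\<in>J. c j * A x j)))"
    have d_J: "(\<Sum>j\<in>J. d j * A i j) = (\<Sum>j\<in>J. c j * A i j)" for i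
      using False by (intro sum.cong) (auto simp: d_def)
    have "(\<Sum>j\<in>insert x J. d j * A i j) = g i" if i: "i \<in> insert x J" for i
    proof (cases "i = x")
      case True
      have "d x * A x x = (A x x * s) * (g x - (\<Sum>j\<in>J. c j * A x j))"
        by (simp add: d_def ac_simps)
      then show ?thesis using True False insert.hyps(1) by (simp add: d_J s[symmetric])
    next
      case ix: False
      then have "i \<in> J" using i by simp
      then have "rank x \<le> rank i" using insert.hyps(2) by force
      then have "A i x = 0" using insert.prems(2)[of i x] \<open>i \<in> J\<close> ix by force
      then show ?thesis using False insert.hyps(1) \<open>i \<in> J\<close> c by (simp add: d_J)
    qed
    then show ?thesis by blast
  qed
qed

text \<open>A nonzero solution would have a nonzero unknown of greatest rank; in the equation at its index
  all the other terms vanish, and the unit coefficient forces it to be zero.\<close>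

lemma triangular_unique:
  fixes A :: "'i \<Rightarrow> 'i \<Rightarrow> 'k::{comm_ring, comm_monoid_mult}" and rank :: "'i \<Rightarrow> nat"
  assumes fin: "finite J"
    and unit: "\<And>i. i \<in> J \<Longrightarrow> A i i dvd 1"
    and tri: "\<And>i j. i \<in> J \<Longrightarrow> j \<in> J \<Longrightarrow> A i j \<noteq> 0 \<Longrightarrow> i = j \<or> rank i < rank j"
    and zero: "\<And>i. i \<in> J \<Longrightarrow> (\<Sum>j\<in>J. c j * A i j) = 0"
    and "i \<in> J"
  shows "c i = 0"
proof (rule ccontr)
  assume "c i \<noteq> 0"
  define K where "K = {i \<in> J. c i \<noteq> 0}"
  have "finite K" "K \<noteq> {}" using fin \<open>i \<in> J\<close> \<open>c i \<noteq> 0\<close> by (auto simp: K_def)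
  then have "Max (rank ` K) \<in> rank ` K" by (intro Max_in) auto
  then obtain x where x: "x \<in> K" "rank x = Max (rank ` K)" by (metis imageE)
  have x_max: "rank y \<le> rank x" if "y \<in> K" for y
    using that x(2) \<open>finite K\<close> by simp
  have xJ: "x \<in> J" using x(1) by (simp add: K_def)
  have "c j * A x j = 0" if "j \<in> J - {x}" for j
  proof (cases "c j = 0")
    case False
    then have "rank j \<le> rank x" using that x_max by (simp add: K_def)
    then have "A x j = 0" using tri[OF xJ, of j] that by force
    then show ?thesis by simp
  qed simp
  then have "(\<Sum>j\<in>J. c j * A x j) = c x * A x x"
    using fin xJ by (simp add: sum.remove[of J x])
  then have cx: "c x * A x x = 0" using zero[OF xJ] by simp
  obtain s where "1 = A x x * s" using unit[OF xJ] by (auto elim: dvdE)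
  then have "c x = (c x * A x x) * s" by (metis mult.assoc mult.right_neutral)
  then show False using cx x(1) by (simp add: K_def)
qed

section \<open>Compositions and their sets of partial sums\<close>

lemma D_singleton: "D [a] = {}"
  by (simp add: D_def)

lemma D_Cons:
  assumes "as \<noteq> []"
  shows "D (a # as) = insert a ((+) a ` D as)"
proof -
  have "{1..length as} = insert 1 (Suc ` {1..length as - 1})"
    using assms by (cases as) (simp_all add: image_Suc_atLeastAtMost atLeastAtMost_insertL)
  moreover have "D \<alpha> = (\<lambda>i. sum_list (take i \<alpha>)) ` {1..length \<alpha> - 1}" for \<alpha>
    by (auto simp: D_def)
  ultimately show ?thesis by (simp add: image_image del: image_Suc_atLeastAtMost)
qed

lemma finite_D: "finite (D \<alpha>)"
  by (simp add: D_def)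

lemma D_pos: "\<alpha> \<in> Comp \<Longrightarrow> x \<in> D \<alpha> \<Longrightarrow> 0 < x"
proof (induction \<alpha> arbitrary: x)
  case (Cons a as)
  then show ?case by (cases "as = []") (auto simp: D_singleton D_Cons Comp_def)
qed (simp add: D_def)

lemma card_D: "\<alpha> \<in> Comp \<Longrightarrow> card (D \<alpha>) = length \<alpha> - 1"
proof (induction \<alpha>)
  case (Cons a as)
  show ?case
  proof (cases "as = []")
    case False
    have as: "as \<in> Comp" using Cons.prems by (simp add: Comp_def)
    then have "a \<notin> (+) a ` D as" using D_pos by fastforce
    then show ?thesis using Cons.IH[OF as] False
      by (simp add: D_Cons finite_D card_image length_greater_0_conv[symmetric]
          del: length_greater_0_conv)
  qed (simp add: D_singleton)
qed (simp add: D_def)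

text \<open>The first part of a composition is the least element of its set of partial sums, and what is
  left of that set, shifted down by the first part, belongs to the remaining parts.\<close>

lemma D_inj:
  "\<alpha> \<in> Comp \<Longrightarrow> \<beta> \<in> Comp \<Longrightarrow> sum_list \<alpha> = sum_list \<beta> \<Longrightarrow> D \<alpha> = D \<beta> \<Longrightarrow> \<alpha> = \<beta>"
proof (induction \<alpha> arbitrary: \<beta>)
  case Nil
  then show ?case by (cases \<beta>) (auto simp: Comp_def)
next
  case (Cons a as)
  obtain b bs where \<beta>: "\<beta> = b # bs" using Cons.prems by (cases \<beta>) (auto simp: Comp_def)
  have C: "as \<in> Comp" "bs \<in> Comp" using Cons.prems \<beta> by (auto simp: Comp_def)
  have ne: "as = [] \<longleftrightarrow> bs = []"
    using Cons.prems(4) \<beta> D_Cons[of as a] D_Cons[of bs b] D_singleton[of a] D_singleton[of b]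
    by (cases "as = []"; cases "bs = []") auto
  show ?case
  proof (cases "as = []")
    case True
    then show ?thesis using Cons.prems \<beta> ne by simp
  next
    case False
    have D: "insert a ((+) a ` D as) = insert b ((+) b ` D bs)"
      using Cons.prems(4) \<beta> False ne by (simp add: D_Cons)
    have "a \<le> b" "b \<le> a" using D by auto
    then have ab: "a = b" by simp
    have "a \<notin> (+) a ` D as" "a \<notin> (+) a ` D bs" using D_pos C by fastforce+
    then have "(+) a ` D as = (+) a ` D bs" using D ab by (metis insert_ident)
    then have "D as = D bs" by (simp add: inj_image_eq_iff)
    then show ?thesis using Cons.IH[OF C] Cons.prems(3) \<beta> ab by simp
  qed
qed

lemma D_subset_imp_shorter:
  assumes "\<alpha> \<in> Comp" "\<beta> \<in> Comp" "sum_list \<beta> = sum_list \<alpha>" "D \<beta> \<subseteq> D \<alpha>" "\<beta> \<noteq> \<alpha>"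
  shows "length \<beta> < length \<alpha>"
proof -
  have "D \<beta> \<subset> D \<alpha>" using D_inj[of \<beta> \<alpha>] assms by auto
  then have "card (D \<beta>) < card (D \<alpha>)" by (simp add: psubset_card_mono finite_D)
  then show ?thesis using card_D assms by simp
qed

section \<open>Coordinates of quasisymmetric functions\<close>

lemma lookup_x_pow:
  assumes "length is = length as" "distinct is"
  shows "Poly_Mapping.lookup (x_pow is as) i
    = (case map_of (zip is as) i of None \<Rightarrow> 0 | Some a \<Rightarrow> a)"
  using assms
proof (induction "is" as rule: list_induct2)
  case Nil
  then show ?case by (simp add: x_pow_def)
next
  case (Cons j "is" a as)
  have "x_pow (j # is) (a # as) = Poly_Mapping.single j a + x_pow is as"
    by (simp add: x_pow_def)
  then show ?case using Cons by (cases "i = j")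
      (auto simp: lookup_add lookup_single split: option.split
        dest!: map_of_SomeD set_zip_leftD)
qed

lemma lookup_x_pow_nth:
  assumes "length is = length as" "distinct is" "k < length as"
  shows "Poly_Mapping.lookup (x_pow is as) (is ! k) = as ! k"
  using assms by (simp add: lookup_x_pow map_of_zip_nth)

text \<open>The index list consists of the variables that occur in the monomial.\<close>

lemma monom_eq_x_pow:
  obtains "is" \<beta> where "length is = length \<beta>" "sorted_wrt (<) is" "\<beta> \<in> Comp" "m = x_pow is \<beta>"
proof
  let ?is = "sorted_list_of_set (Poly_Mapping.keys m)"
  let ?\<beta> = "map (Poly_Mapping.lookup m) ?is"
  show "m = x_pow ?is ?\<beta>"
  proof (rule poly_mapping_eqI)
    fix i
    show "Poly_Mapping.lookup m i = Poly_Mapping.lookup (x_pow ?is ?\<beta>) i"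
      by (simp add: lookup_x_pow map_of_zip_map in_keys_iff)
  qed
qed (auto simp: Comp_def in_keys_iff)

lemma mdeg_x_pow:
  assumes "length is = length \<beta>" "sorted_wrt (<) is" "\<beta> \<in> Comp"
  shows "mdeg (x_pow is \<beta>) = sum_list \<beta>"
proof -
  have dist: "distinct is" using assms(2) strict_sorted_iff by blast
  have "mdeg (x_pow is \<beta>) = (\<Sum>i\<in>set is. Poly_Mapping.lookup (x_pow is \<beta>) i)"
    using keys_x_pow[of "is" \<beta>] assms by (simp add: mdeg_def Comp_def)
  also have "\<dots> = sum_list (map (Poly_Mapping.lookup (x_pow is \<beta>)) is)"
    using dist by (simp add: sum_list_distinct_conv_sum_set)
  also have "map (Poly_Mapping.lookup (x_pow is \<beta>)) is = \<beta>"
    using assms(1) dist by (intro nth_equalityI) (simp_all add: lookup_x_pow_nth)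
  finally show ?thesis .
qed

lemma M_x_pow:
  assumes "length is = length \<beta>" "sorted_wrt (<) is" "\<beta> \<in> Comp" "\<gamma> \<in> Comp"
  shows "M \<gamma> (x_pow is \<beta>) = (if \<gamma> = \<beta> then 1 else 0)"
proof -
  have "\<beta> = \<gamma>" if js: "length js = length \<gamma>" "sorted_wrt (<) js" "x_pow is \<beta> = x_pow js \<gamma>" for js
  proof -
    have "set is = set js"
      using keys_x_pow[of "is" \<beta>] keys_x_pow[of js \<gamma>] assms js by (simp add: Comp_def)
    then have eq: "is = js" using assms(2) js(2) by (intro strict_sorted_equal) auto
    have "distinct is" using assms(2) strict_sorted_iff by blast
    then show ?thesis using assms(1) js eq
      by (intro nth_equalityI) (simp, metis lookup_x_pow_nth)
  qed
  then show ?thesis using assms(1,2) unfolding M_def by auto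
qed

lemma eta_x_pow:
  assumes "length is = length \<beta>" "sorted_wrt (<) is" "\<beta> \<in> Comp"
  shows "eta q \<alpha> (x_pow is \<beta>)
    = (if sum_list \<beta> = sum_list \<alpha> \<and> D \<beta> \<subseteq> D \<alpha> then (q + 1) ^ length \<beta> else 0)"
proof -
  let ?B = "{\<gamma>. \<gamma> \<in> Comp_n (sum_list \<alpha>) \<and> D \<gamma> \<subseteq> D \<alpha>}"
  have "eta q \<alpha> (x_pow is \<beta>) = (\<Sum>\<gamma>\<in>?B. if \<gamma> = \<beta> then (q + 1) ^ length \<beta> else 0)"
    unfolding eta_def using assms
    by (intro sum.cong) (auto simp: M_x_pow Comp_n_def)
  moreover have "finite ?B" using finite_Comp_n by simp
  ultimately show ?thesis using assms(3) by (simp add: sum.delta Comp_n_def)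
qed

text \<open>For the initial index list \<open>[0..<length \<beta>]\<close> the coefficient at \<open>x_pow is \<beta>\<close> is the
  coordinate of a quasisymmetric function at \<open>M \<beta>\<close>.\<close>

lemma QSym_x_pow_initial:
  assumes "f \<in> QSym" "length is = length \<beta>" "sorted_wrt (<) is" "\<beta> \<in> Comp"
  shows "f (x_pow is \<beta>) = f (x_pow [0..<length \<beta>] \<beta>)"
proof -
  have "length [0..<length \<beta>] = length \<beta>" "sorted_wrt (<) [0..<length \<beta>]" by simp_all
  then show ?thesis using assms unfolding QSym_def Comp_def by blast
qed

lemma eta_nonzero_mdeg: "eta q \<alpha> m \<noteq> 0 \<Longrightarrow> mdeg m = sum_list \<alpha>"
  by (rule monom_eq_x_pow[of m]) (auto simp: eta_x_pow mdeg_x_pow split: if_splits)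

lemma eta_in_QSym: "eta q \<alpha> \<in> QSym"
proof -
  have "\<forall>m. eta q \<alpha> m \<noteq> 0 \<longrightarrow> mdeg m \<le> sum_list \<alpha>"
    using eta_nonzero_mdeg by fastforce
  then show ?thesis unfolding QSym_def by (auto simp: eta_x_pow Comp_def)
qed

lemma is_submodule_QSym_n: "is_submodule (QSym_n n)"
proof -
  have "f m \<noteq> 0 \<or> g m \<noteq> 0" if "f m + g m \<noteq> 0" for f g :: "'a series" and m
    using that by auto
  moreover have "f m \<noteq> 0" if "c * f m \<noteq> 0" for c and f :: "'a series" and m
    using that by auto
  ultimately show ?thesis
    using is_submodule_QSym[where 'a = 'a] unfolding is_submodule_def QSym_n_def by simp blast
qed

section \<open>The enriched monomial functions form a basis\<close>

lemma unit_power: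
  fixes r :: "'k::{comm_ring, comm_monoid_mult}"
  assumes "r dvd 1"
  shows "r ^ n dvd 1"
proof -
  obtain s where "1 = r * s" using assms by (auto elim: dvdE)
  then have "1 = r ^ n * s ^ n" by (metis power_mult_distrib power_one)
  then show ?thesis by (rule dvdI)
qed

lemma eta_triangular:
  assumes "\<alpha> \<in> Comp" "\<beta> \<in> Comp" "eta q \<alpha> (x_pow [0..<length \<beta>] \<beta>) \<noteq> 0"
  shows "\<beta> = \<alpha> \<or> length \<beta> < length \<alpha>"
  using assms D_subset_imp_shorter by (auto simp: eta_x_pow split: if_splits)

lemma eta_diagonal:
  assumes "(q + 1) dvd 1" "\<alpha> \<in> Comp"
  shows "eta q \<alpha> (x_pow [0..<length \<alpha>] \<alpha>) dvd 1"
  using assms by (simp add: eta_x_pow unit_power)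

lemma eta_independent:
  assumes "(q + 1) dvd 1" "finite J" "J \<subseteq> Comp" "lincomb c (eta q) J = (\<lambda>m. 0)" "\<alpha> \<in> J"
  shows "c \<alpha> = 0"
proof (rule triangular_unique[where rank = length and J = J and c = c and i = \<alpha>
      and A = "\<lambda>\<beta> \<alpha>. eta q \<alpha> (x_pow [0..<length \<beta>] \<beta>)"])
  show "(\<Sum>\<alpha>\<in>J. c \<alpha> * eta q \<alpha> (x_pow [0..<length \<beta>] \<beta>)) = 0" for \<beta>
    using fun_cong[OF assms(4)] by (simp add: lincomb_def)
  show "eta q \<alpha> (x_pow [0..<length \<alpha>] \<alpha>) dvd 1" if "\<alpha> \<in> J" for \<alpha>
    using eta_diagonal[OF assms(1)] assms(3) that by blast
  show "\<beta> = \<alpha> \<or> length \<beta> < length \<alpha>"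
    if "\<beta> \<in> J" "\<alpha> \<in> J" "eta q \<alpha> (x_pow [0..<length \<beta>] \<beta>) \<noteq> 0" for \<alpha> \<beta>
    using eta_triangular[OF _ _ that(3)] assms(3) that(1,2) by blast
qed (fact assms)+

text \<open>The set of all compositions with size in \<open>S\<close> contains every composition at which some of the
  functions involved has a nonzero coordinate. Solving for these coordinates therefore settles all of
  them.\<close>

lemma eta_spans:
  assumes r: "(q + 1) dvd 1" and f: "f \<in> QSym" and "finite S"
    and supp: "\<And>m. f m \<noteq> 0 \<Longrightarrow> mdeg m \<in> S"
  shows "\<exists>c. f = lincomb c (eta q) (\<Union>n\<in>S. Comp_n n)"
proof -
  let ?J = "\<Union>n\<in>S. Comp_n n"
  let ?x = "\<lambda>\<beta>. x_pow [0..<length \<beta>] \<beta>"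
  have JC: "?J \<subseteq> Comp" by (auto simp: Comp_n_def)
  have "\<exists>c. \<forall>\<beta>\<in>?J. (\<Sum>\<alpha>\<in>?J. c \<alpha> * eta q \<alpha> (?x \<beta>)) = f (?x \<beta>)"
  proof (rule triangular_solvable[where rank = length and J = ?J
        and A = "\<lambda>\<beta> \<alpha>. eta q \<alpha> (?x \<beta>)" and g = "\<lambda>\<beta>. f (?x \<beta>)"])
    show "finite ?J" using \<open>finite S\<close> finite_Comp_n by blast
    show "eta q \<alpha> (?x \<alpha>) dvd 1" if "\<alpha> \<in> ?J" for \<alpha>
      using eta_diagonal[OF r] JC that by blast
    show "\<beta> = \<alpha> \<or> length \<beta> < length \<alpha>"
      if "\<beta> \<in> ?J" "\<alpha> \<in> ?J" "eta q \<alpha> (?x \<beta>) \<noteq> 0" for \<alpha> \<beta>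
      using eta_triangular[OF _ _ that(3)] JC that(1,2) by blast
  qed
  then obtain c where c: "\<And>\<beta>. \<beta> \<in> ?J \<Longrightarrow> (\<Sum>\<alpha>\<in>?J. c \<alpha> * eta q \<alpha> (?x \<beta>)) = f (?x \<beta>)"
    by blast
  have "f m = lincomb c (eta q) ?J m" for m
  proof -
    obtain "is" \<beta> where m: "length is = length \<beta>" "sorted_wrt (<) is" "\<beta> \<in> Comp" "m = x_pow is \<beta>"
      by (rule monom_eq_x_pow)
    show ?thesis
    proof (cases "sum_list \<beta> \<in> S")
      case True
      then have "\<beta> \<in> ?J" using m(3) by (auto simp: Comp_n_def)
      have x: "g m = g (?x \<beta>)" if "g \<in> QSym" for g :: "'a series"
        using QSym_x_pow_initial[OF that m(1-3)] m(4) by simp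
      have "f m = (\<Sum>\<alpha>\<in>?J. c \<alpha> * eta q \<alpha> (?x \<beta>))" using c[OF \<open>\<beta> \<in> ?J\<close>] x[OF f] by simp
      also have "\<dots> = lincomb c (eta q) ?J m" by (simp only: lincomb_def x[OF eta_in_QSym])
      finally show ?thesis .
    next
      case False
      have deg: "mdeg m = sum_list \<beta>" using m mdeg_x_pow by simp
      then have "eta q \<alpha> m = 0" if "\<alpha> \<in> ?J" for \<alpha>
        using that False eta_nonzero_mdeg[of q \<alpha> m] deg by (cases "eta q \<alpha> m = 0") (auto simp: Comp_n_def)
      then have "lincomb c (eta q) ?J m = 0" unfolding lincomb_def by (intro sum.neutral) auto
      then show ?thesis using supp[of m] False deg by auto
    qed
  qed
  then show ?thesis by blast
qed

theorem theorem3p10: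
  fixes q :: "'k::{comm_ring, comm_monoid_mult}"
  assumes "(q + 1) dvd 1"
  shows "is_basis QSym Comp (eta q) \<and>
         (\<forall>n. is_basis (QSym_n n) (Comp_n n) (eta q))"
proof -
  have QSym: "is_basis QSym Comp (eta q)"
    unfolding is_basis_def
  proof (intro conjI ballI allI impI)
    show "is_submodule (QSym :: 'k series set)" by (rule is_submodule_QSym)
  next
    show "eta q \<alpha> \<in> QSym" for \<alpha> by (rule eta_in_QSym)
  next
    fix J and c :: "nat list \<Rightarrow> 'k" and \<alpha>
    assume "finite J \<and> J \<subseteq> Comp \<and> lincomb c (eta q) J = (\<lambda>m. 0)" "\<alpha> \<in> J"
    then show "c \<alpha> = 0" using eta_independent[OF assms, of J c \<alpha>] by simp
  next
    fix f :: "'k series" assume f: "f \<in> QSym"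
    obtain d where "\<And>m. f m \<noteq> 0 \<Longrightarrow> mdeg m \<in> {..d}" using f by (auto simp: QSym_def)
    then obtain c where "f = lincomb c (eta q) (\<Union>n\<in>{..d}. Comp_n n)"
      using eta_spans[OF assms f, of "{..d}"] by blast
    moreover have "finite (\<Union>n\<in>{..d}. Comp_n n)" using finite_Comp_n by blast
    moreover have "(\<Union>n\<in>{..d}. Comp_n n) \<subseteq> Comp" by (auto simp: Comp_n_def)
    ultimately show "\<exists>J c. finite J \<and> J \<subseteq> Comp \<and> f = lincomb c (eta q) J" by blast
  qed
  have QSym_n: "is_basis (QSym_n n) (Comp_n n) (eta q)" for n
    unfolding is_basis_def
  proof (intro conjI ballI allI impI)
    show "is_submodule (QSym_n n :: 'k series set)" by (rule is_submodule_QSym_n)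
  next
    show "eta q \<alpha> \<in> QSym_n n" if "\<alpha> \<in> Comp_n n" for \<alpha>
      using that eta_in_QSym eta_nonzero_mdeg by (auto simp: QSym_n_def Comp_n_def)
  next
    fix J and c :: "nat list \<Rightarrow> 'k" and \<alpha>
    assume J: "finite J \<and> J \<subseteq> Comp_n n \<and> lincomb c (eta q) J = (\<lambda>m. 0)" "\<alpha> \<in> J"
    then have "J \<subseteq> Comp" by (auto simp: Comp_n_def)
    then show "c \<alpha> = 0" using eta_independent[OF assms, of J c \<alpha>] J by simp
  next
    fix f :: "'k series" assume "f \<in> QSym_n n"
    then have "f \<in> QSym" "\<And>m. f m \<noteq> 0 \<Longrightarrow> mdeg m \<in> {n}" by (auto simp: QSym_n_def)
    then obtain c where "f = lincomb c (eta q) (Comp_n n)"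
      using eta_spans[OF assms, of f "{n}"] by auto
    then show "\<exists>J c. finite J \<and> J \<subseteq> Comp_n n \<and> f = lincomb c (eta q) J"
      using finite_Comp_n by blast
  qed
  show ?thesis using QSym QSym_n by blast
qed

end
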